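(* Let $A\in\mathbb{S}^n_+$ and $B\in\mathbb{S}^n$, let $E=\{A+tB : t\in\mathbb{R}\}$ be a line, and let $\{U_k\}$ be the sequence of alternating projections for $\mathbb{S}^n_+$ and $E$, i.e. $U_{k+1}=P_E(P_{\mathbb{S}^n_+}(U_k))$ for $k=0,1,2,\ldots$ with $U_0\in E$. If $\mathbb{S}^n_+\cap E=\{A\}$, then $\|U_k-A\|=O(k^{-1/2})$ as $k\to\infty$.
   Context: $\mathbb{S}^n$ is the space of real symmetric $n\times n$ matrices with inner product $\langle U,V\rangle=\operatorname{tr}(UV)$ and Frobenius norm $\|U\|=\sqrt{\langle U,U\rangle}$; $\mathbb{S}^n_+$ is the cone of positive semidefinite matrices in $\mathbb{S}^n$. For a closed convex set $H\subset\mathbb{S}^n$, $P_H(U)=\operatorname{argmin}_{X\in H}\|X-U\|$ is the projection onto $H$. That $E$ is a line means $B\neq O$. *)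

theory Defs
  imports "HOL-Analysis.Analysis" "HOL-Library.Landau_Symbols"
begin

definition sym_matrices :: "(real ^ 'n ^ 'n) set" where
  "sym_matrices = {X. transpose X = X}"

definition psd_cone :: "(real ^ 'n ^ 'n) set" where
  "psd_cone = {X \<in> sym_matrices. \<forall>x. 0 \<le> x \<bullet> (X *v x)}"

definition matrix_line :: "real ^ 'n ^ 'n \<Rightarrow> real ^ 'n ^ 'n \<Rightarrow> (real ^ 'n ^ 'n) set" where
  "matrix_line A B = {A + t *\<^sub>R B | t. t \<in> UNIV}"

text \<open>
  The inner product and norm of the type \<^typ>\<open>real ^ 'n ^ 'n\<close> are, on symmetric matrices, the
  trace inner product and the Frobenius norm. Hence \<^const>\<open>closest_point\<close> is the projection with
  respect to the Frobenius norm; it is the unique minimiser for the nonempty closed convex sets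
  used here.
\<close>

lemma inner_sym_matrices:
  assumes "U \<in> sym_matrices"
  shows "U \<bullet> V = trace (U ** V)"
proof -
  have sym: "U $ i $ j = U $ j $ i" for i j
    using assms by (metis (mono_tags) sym_matrices_def mem_Collect_eq transpose_def vec_lambda_beta)
  have "U \<bullet> V = (\<Sum>i\<in>UNIV. \<Sum>j\<in>UNIV. U $ j $ i * V $ i $ j)"
    using sym by (simp add: inner_vec_def)
  also have "\<dots> = trace (U ** V)"
    unfolding trace_def matrix_matrix_mult_def by (simp, rule sum.swap)
  finally show ?thesis .
qed

lemma norm_sym_matrices: "U \<in> sym_matrices \<Longrightarrow> norm U = sqrt (trace (U ** U))"
  by (simp add: norm_eq_sqrt_inner inner_sym_matrices)

lemma subspace_sym_matrices: "subspace sym_matrices"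
  by (auto simp: subspace_def sym_matrices_def transpose_def vec_eq_iff)

lemma psd_cone_nonempty: "psd_cone \<noteq> {}"
  using subspace_0[OF subspace_sym_matrices] by (auto simp: psd_cone_def)

lemma psd_cone_convex: "convex psd_cone"
  unfolding convex_def
  by (auto simp: psd_cone_def matrix_vector_mult_add_rdistrib scaleR_matrix_vector_assoc[symmetric]
      inner_add_right subspace_add[OF subspace_sym_matrices] subspace_mul[OF subspace_sym_matrices])

lemma psd_cone_closed: "closed psd_cone"
proof -
  have "psd_cone = sym_matrices \<inter> (\<Inter>x. {X. 0 \<le> x \<bullet> (X *v x)})"
    by (auto simp: psd_cone_def)
  moreover have "closed {X :: real ^ 'n ^ 'n. 0 \<le> x \<bullet> (X *v x)}" for x
    unfolding matrix_vector_mult_def inner_vec_def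
    by (intro closed_Collect_le continuous_intros)
  ultimately show ?thesis
    by (metis (no_types, lifting) closed_INT closed_Int closed_subspace subspace_sym_matrices)
qed

lemma matrix_line_affine: "affine (matrix_line A B)"
  unfolding affine_alt matrix_line_def
proof clarsimp
  fix s t u :: real
  have "(1 - u) *\<^sub>R (A + s *\<^sub>R B) + u *\<^sub>R (A + t *\<^sub>R B) = A + ((1 - u) * s + u * t) *\<^sub>R B"
    by (simp add: algebra_simps)
  then show "\<exists>r. (1 - u) *\<^sub>R (A + s *\<^sub>R B) + u *\<^sub>R (A + t *\<^sub>R B) = A + r *\<^sub>R B"
    by blast
qed

lemma matrix_line_nonempty: "A \<in> matrix_line A B"
  unfolding matrix_line_def by (auto intro: exI[of _ 0])

lemma closest_point_minimiser:
  fixes H :: "(real ^ 'n ^ 'n) set"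
  assumes "closed H" "convex H" "H \<noteq> {}"
  shows "X = closest_point H U \<longleftrightarrow> X \<in> H \<and> (\<forall>Y\<in>H. norm (X - U) \<le> norm (Y - U))"
proof -
  have "closest_point H U \<in> H \<and> (\<forall>Y\<in>H. dist U (closest_point H U) \<le> dist U Y)"
    using closest_point_exists[OF assms(1,3)] by blast
  moreover have "X = closest_point H U" if "X \<in> H" "\<forall>Y\<in>H. dist U X \<le> dist U Y"
    using closest_point_unique[OF assms(2,1) that] .
  ultimately show ?thesis
    by (metis dist_norm norm_minus_commute)
qed

definition alternating_projections ::
  "(real ^ 'n ^ 'n) set \<Rightarrow> (real ^ 'n ^ 'n) set \<Rightarrow> (nat \<Rightarrow> real ^ 'n ^ 'n) \<Rightarrow> bool" where
  "alternating_projections K E U \<longleftrightarrow>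
     U 0 \<in> E \<and> (\<forall>k. U (Suc k) = closest_point E (closest_point K (U k)))"

end

theory Submission
  imports Defs
begin

text \<open>
  Write \<open>K\<close> for the positive semidefinite cone and \<open>E\<close> for the line. Two facts give the rate.

  The first is general: if \<open>a\<close> lies in both of two closed convex sets, one round of alternating
  projections satisfies \<open>\<parallel>u' - a\<parallel>\<^sup>2 \<le> \<parallel>u - a\<parallel>\<^sup>2 - dist(u, K)\<^sup>2\<close>
  (\<open>alternating_projection_decrease\<close>).

  The second is a quadratic error bound: on bounded pieces of the line,
  \<open>dist(A + t B, K) \<ge> c t\<^sup>2\<close> (\<open>psd_cone_quadratic_error_bound\<close>). It is here that the dimension one
  of \<open>E\<close> enters. A vector \<open>x\<close> of bounded norm with \<open>x \<bullet> (A + t B) x \<le> - c t\<^sup>2\<close> certifies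
  the bound, and for \<open>t > 0\<close> such vectors come from the kernel of \<open>A\<close>. If \<open>z \<bullet> B z < 0\<close> for some
  \<open>z\<close> in the kernel, then \<open>z\<close> itself works, even with a bound linear in \<open>t\<close>. If some \<open>z\<close> in the
  kernel has \<open>z \<bullet> B z = 0\<close> but \<open>B z \<noteq> 0\<close>, tilting it to \<open>z - s t B z\<close> makes the form negative
  of order \<open>t\<^sup>2\<close>. In the only remaining case \<open>z \<bullet> B z \<ge> 0\<close> for all \<open>z\<close> in the kernel of \<open>A\<close>,
  with equality only at common null vectors of \<open>A\<close> and \<open>B\<close>. Modulo these, compactness bounds
  \<open>x \<bullet> A x\<close> below by a positive constant on the unit vectors with \<open>x \<bullet> B x \<le> 0\<close>, so \<open>A + t B\<close>
  is positive semidefinite for some \<open>t > 0\<close>, which contradicts \<open>K \<inter> E = {A}\<close>. Negative \<open>t\<close> is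
  the same with \<open>- B\<close>.

  Together, \<open>s k = \<parallel>U k - A\<parallel>\<^sup>2\<close> satisfies \<open>s (k + 1) \<le> s k - d (s k)\<^sup>2\<close> for some \<open>d > 0\<close>, and
  such a sequence is at most \<open>1 / (d k)\<close>.
\<close>

section \<open>Quadratic forms of symmetric matrices\<close>

lemma sym_matrix_inner_commute:
  fixes M :: "real ^ 'n ^ 'n"
  assumes "M \<in> sym_matrices"
  shows "x \<bullet> (M *v y) = y \<bullet> (M *v x)"
proof -
  have "x v* M = M *v x"
    using assms by (metis (mono_tags) mem_Collect_eq sym_matrices_def vector_transpose_matrix)
  then show ?thesis
    by (metis dot_lmul_matrix inner_commute)
qed

lemma quadratic_form_add_scaleR:
  fixes M :: "real ^ 'n ^ 'n"
  assumes "M \<in> sym_matrices"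
  shows "(x + r *\<^sub>R y) \<bullet> (M *v (x + r *\<^sub>R y))
    = x \<bullet> (M *v x) + 2 * r * (y \<bullet> (M *v x)) + r\<^sup>2 * (y \<bullet> (M *v y))"
  using sym_matrix_inner_commute[OF assms, of x y]
  by (simp add: matrix_vector_right_distrib matrix_vector_mult_scaleR inner_add_left
      inner_add_right power2_eq_square algebra_simps)

lemma quadratic_form_line:
  fixes A B :: "real ^ 'n ^ 'n"
  shows "x \<bullet> ((A + t *\<^sub>R B) *v x) = x \<bullet> (A *v x) + t * (x \<bullet> (B *v x))"
  by (simp add: matrix_vector_mult_add_rdistrib scaleR_matrix_vector_assoc[symmetric] inner_add_right)

lemma norm_matrix_vector_mult_le:
  fixes M :: "real ^ 'n ^ 'm"
  shows "norm (M *v x) \<le> norm M * norm x"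
proof -
  have "norm (M *v x) = L2_set (\<lambda>i. \<bar>M $ i \<bullet> x\<bar>) UNIV"
    by (simp add: norm_vec_def matrix_mult_dot)
  also have "\<dots> \<le> L2_set (\<lambda>i. norm (M $ i) * norm x) UNIV"
    by (intro L2_set_mono) (auto simp: Cauchy_Schwarz_ineq2)
  also have "\<dots> = norm M * norm x"
    by (simp add: norm_vec_def L2_set_left_distrib)
  finally show ?thesis .
qed

lemma quadratic_form_abs_le:
  fixes M :: "real ^ 'n ^ 'n"
  shows "\<bar>x \<bullet> (M *v x)\<bar> \<le> norm M * (norm x)\<^sup>2"
proof -
  have "\<bar>x \<bullet> (M *v x)\<bar> \<le> norm x * norm (M *v x)"
    by (rule Cauchy_Schwarz_ineq2)
  also have "\<dots> \<le> norm x * (norm M * norm x)"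
    by (intro mult_left_mono norm_matrix_vector_mult_le) auto
  finally show ?thesis
    by (simp add: power2_eq_square mult_ac)
qed

text \<open>
  A zero of a nonnegative quadratic form is a minimum of it, hence a critical point. Concretely,
  moving from \<open>x\<close> in the direction \<open>- A x\<close> would make the form negative if \<open>A x\<close> did not vanish.
\<close>

lemma psd_null_vector_in_kernel:
  fixes A :: "real ^ 'n ^ 'n"
  assumes A: "A \<in> psd_cone" and x: "x \<bullet> (A *v x) = 0"
  shows "A *v x = 0"
proof (rule ccontr)
  assume nz: "A *v x \<noteq> 0"
  define w where "w = A *v x"
  define a where "a = w \<bullet> (A *v w)"
  define s where "s = (w \<bullet> w) / (a + 1)"
  have sym: "A \<in> sym_matrices" and a: "a \<ge> 0"
    using A by (auto simp: psd_cone_def a_def)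
  have w: "w \<bullet> w > 0"
    using nz by (simp add: w_def)
  then have s: "s > 0" and sa: "s * a < w \<bullet> w"
    using a by (auto simp: s_def field_simps)
  have "(x + (- s) *\<^sub>R w) \<bullet> (A *v (x + (- s) *\<^sub>R w)) = s * (s * a - 2 * (w \<bullet> w))"
    unfolding quadratic_form_add_scaleR[OF sym] x
    by (simp add: a_def w_def[symmetric] power2_eq_square algebra_simps)
  moreover have "\<dots> < 0"
  proof -
    have "s * a - 2 * (w \<bullet> w) < 0"
      using sa w by linarith
    with s show ?thesis by (rule mult_pos_neg)
  qed
  ultimately show False
    using A by (metis (mono_tags, lifting) mem_Collect_eq not_less psd_cone_def)
qed

section \<open>The distance from the line to the cone\<close>

text \<open>
  On vectors with \<open>x \<bullet> B x > 0\<close> adding \<open>t B\<close> does no harm, so only those with \<open>x \<bullet> B x \<le> 0\<close>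
  matter. Splitting off the common null vectors \<open>M\<close> changes neither form, and on the unit sphere
  of the orthogonal complement of \<open>M\<close> the vectors with \<open>x \<bullet> B x \<le> 0\<close> form a compact set on which
  the hypotheses leave no zero of \<open>x \<bullet> A x\<close>.
\<close>

lemma psd_direction_of_kernel_condition:
  fixes A B :: "real ^ 'n ^ 'n"
  assumes A: "A \<in> psd_cone" and B: "B \<in> sym_matrices"
    and nonneg: "\<And>z. A *v z = 0 \<Longrightarrow> z \<bullet> (B *v z) \<ge> 0"
    and null: "\<And>z. A *v z = 0 \<Longrightarrow> z \<bullet> (B *v z) = 0 \<Longrightarrow> B *v z = 0"
  shows "\<exists>t>0. A + t *\<^sub>R B \<in> psd_cone"
proof -
  have symA: "A \<in> sym_matrices"
    using A by (simp add: psd_cone_def)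
  define M where "M = {z. A *v z = 0 \<and> B *v z = 0}"
  have M: "subspace M"
    by (auto simp: subspace_def M_def matrix_vector_right_distrib matrix_vector_mult_scaleR)
  define P where "P = sphere 0 1 \<inter> M\<^sup>\<bottom> \<inter> {x. x \<bullet> (B *v x) \<le> 0}"
  have "closed {x. x \<bullet> (B *v x) \<le> 0}"
    by (intro closed_Collect_le continuous_intros)
  then have P: "compact P"
    using closed_subspace[OF subspace_orthogonal_comp[of M]]
    unfolding P_def by (intro compact_Int_closed) auto
  have pos: "x \<bullet> (A *v x) > 0" if "x \<in> P" for x
  proof (rule ccontr)
    assume "\<not> x \<bullet> (A *v x) > 0"
    with A have "A *v x = 0"
      by (intro psd_null_vector_in_kernel) (auto simp: psd_cone_def intro: antisym)
    moreover from this have "B *v x = 0"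
      using nonneg[of x] null[of x] that by (auto simp: P_def)
    ultimately have "x \<in> M"
      by (simp add: M_def)
    with that have "x \<bullet> x = 0" "norm x = 1"
      by (auto simp: P_def orthogonal_comp_def orthogonal_def)
    then show False by simp
  qed
  obtain a where a: "a > 0" and a_le: "\<And>x. x \<in> P \<Longrightarrow> a \<le> x \<bullet> (A *v x)"
  proof (cases "P = {}")
    case True
    then show ?thesis using that[of 1] by simp
  next
    case False
    have "continuous_on P (\<lambda>x. x \<bullet> (A *v x))"
      by (intro continuous_intros)
    with P False obtain x where "x \<in> P" "\<forall>y\<in>P. x \<bullet> (A *v x) \<le> y \<bullet> (A *v y)"
      using continuous_attains_inf by blast
    then show ?thesis using that pos by blast
  qed
  define t where "t = a / (norm B + 1)"
  have "norm B + 1 > 0"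
    by (simp add: add_nonneg_pos)
  then have t: "t > 0" and tB: "t * norm B \<le> a"
    using a by (auto simp: t_def field_simps)
  have sphere: "u \<bullet> ((A + t *\<^sub>R B) *v u) \<ge> 0" if u: "u \<in> M\<^sup>\<bottom>" "norm u = 1" for u
  proof (cases "u \<bullet> (B *v u) \<le> 0")
    case True
    then have "a \<le> u \<bullet> (A *v u)"
      using u by (intro a_le) (simp add: P_def)
    moreover have "t * (- (u \<bullet> (B *v u))) \<le> t * norm B"
      using quadratic_form_abs_le[of u B] u t by (intro mult_left_mono) auto
    ultimately show ?thesis
      using tB by (simp add: quadratic_form_line)
  next
    case False
    then show ?thesis
      using A t by (auto simp: quadratic_form_line psd_cone_def)
  qed
  have "x \<bullet> ((A + t *\<^sub>R B) *v x) \<ge> 0" for x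
  proof -
    obtain m y where "m \<in> span M" and orth: "\<And>w. w \<in> span M \<Longrightarrow> orthogonal y w"
      and x: "x = m + y"
      using orthogonal_subspace_decomp_exists[of M x] by blast
    have span: "span M = M"
      using M by (simp only: span_eq_iff)
    have m: "m \<in> M"
      using \<open>m \<in> span M\<close> by (simp only: span)
    have y: "y \<in> M\<^sup>\<bottom>"
      using orth by (simp add: span orthogonal_comp_def orthogonal_commute)
    have "x \<bullet> ((A + t *\<^sub>R B) *v x) = y \<bullet> ((A + t *\<^sub>R B) *v y)"
      using m unfolding quadratic_form_line x
      using quadratic_form_add_scaleR[OF symA, of m 1 y] quadratic_form_add_scaleR[OF B, of m 1 y]
      by (simp add: M_def)
    also have "\<dots> \<ge> 0"
    proof (cases "y = 0")
      case False
      define u where "u = y /\<^sub>R norm y"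
      have "y = norm y *\<^sub>R u"
        using False by (simp add: u_def)
      then have "y \<bullet> ((A + t *\<^sub>R B) *v y) = (norm y)\<^sup>2 * (u \<bullet> ((A + t *\<^sub>R B) *v u))"
        by (metis (no_types, lifting) inner_scaleR_left inner_scaleR_right matrix_vector_mult_scaleR
            mult.assoc power2_eq_square)
      moreover have "u \<in> M\<^sup>\<bottom>"
        using y by (auto simp: u_def intro: subspace_mul subspace_orthogonal_comp)
      ultimately show ?thesis
        using sphere[of u] False by (simp add: u_def)
    qed simp
    finally show ?thesis .
  qed
  moreover have "A + t *\<^sub>R B \<in> sym_matrices"
    using symA B by (intro subspace_add subspace_mul subspace_sym_matrices)
  ultimately show ?thesis
    using t by (auto simp: psd_cone_def)
qed

text \<open>
  A Schur complement governs the size \<open>t\<^sup>2\<close>: when \<open>B\<close> vanishes to first order at a null vector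
  \<open>z\<close> of \<open>A\<close>, the coupling \<open>t (B z)\<close> between \<open>z\<close> and the rest of the space is still negative at
  second order.
\<close>

lemma negative_vectors_along_ray:
  fixes A B :: "real ^ 'n ^ 'n"
  assumes A: "A \<in> psd_cone" and B: "B \<in> sym_matrices" and T: "T > 0"
    and leaves: "\<And>t. t > 0 \<Longrightarrow> A + t *\<^sub>R B \<notin> psd_cone"
  obtains c R where "c > 0" "R > 0"
    "\<And>t. 0 \<le> t \<Longrightarrow> t \<le> T \<Longrightarrow> \<exists>x. norm x \<le> R \<and> x \<bullet> ((A + t *\<^sub>R B) *v x) \<le> - c * t\<^sup>2"
proof -
  have symA: "A \<in> sym_matrices"
    using A by (simp add: psd_cone_def)
  from psd_direction_of_kernel_condition[OF A B] leaves
  consider (first) z where "A *v z = 0" "z \<bullet> (B *v z) < 0"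
    | (second) z where "A *v z = 0" "z \<bullet> (B *v z) = 0" "B *v z \<noteq> 0"
    by (meson not_le)
  then show ?thesis
  proof cases
    case first
    define c where "c = - (z \<bullet> (B *v z)) / T"
    show ?thesis
    proof (rule that[of c "norm z + 1"])
      fix t assume t: "0 \<le> t" "t \<le> T"
      have "z \<bullet> ((A + t *\<^sub>R B) *v z) = - c * (t * T)"
        using first T by (simp add: quadratic_form_line c_def)
      also have "\<dots> \<le> - c * t\<^sup>2"
        using t first T by (intro mult_left_mono_neg) (auto simp: c_def power2_eq_square mult_left_mono divide_nonpos_pos)
      finally show "\<exists>x. norm x \<le> norm z + 1 \<and> x \<bullet> ((A + t *\<^sub>R B) *v x) \<le> - c * t\<^sup>2"
        by (intro exI[of _ z]) auto
    qed (use first T in \<open>auto simp: c_def add_nonneg_pos divide_neg_pos divide_nonpos_pos\<close>)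
  next
    case second
    define w where "w = B *v z"
    define a where "a = w \<bullet> (A *v w)"
    define b where "b = \<bar>w \<bullet> (B *v w)\<bar>"
    define s where "s = (w \<bullet> w) / (a + T * b + 1)"
    have w: "w \<bullet> w > 0"
      using second by (simp add: w_def)
    have a: "a \<ge> 0"
      using A by (simp add: a_def psd_cone_def)
    have ab: "a + T * b \<ge> 0"
      using a T by (simp add: b_def)
    then have s: "s > 0" and sab: "s * (a + T * b) \<le> w \<bullet> w"
      using w by (auto simp: s_def field_simps)
    show ?thesis
    proof (rule that[of "s * (w \<bullet> w)" "norm z + s * T * norm w + 1"])
      fix t assume t: "0 \<le> t" "t \<le> T"
      let ?x = "z + (- (s * t)) *\<^sub>R w"
      have "norm ?x \<le> norm z + norm ((- (s * t)) *\<^sub>R w)"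
        by (rule norm_triangle_ineq)
      also have "\<dots> = norm z + s * t * norm w"
        using s t by (simp add: abs_mult)
      also have "\<dots> \<le> norm z + s * T * norm w"
        using s t by (intro add_left_mono mult_right_mono mult_left_mono) auto
      finally have "norm ?x \<le> norm z + s * T * norm w + 1" by simp
      moreover have "?x \<bullet> ((A + t *\<^sub>R B) *v ?x) \<le> - (s * (w \<bullet> w)) * t\<^sup>2"
      proof -
        have "?x \<bullet> ((A + t *\<^sub>R B) *v ?x)
            = s * t\<^sup>2 * (s * (a + t * (w \<bullet> (B *v w))) - 2 * (w \<bullet> w))"
          using second(1,2)
          unfolding quadratic_form_line
            quadratic_form_add_scaleR[OF symA] quadratic_form_add_scaleR[OF B]
          by (simp add: a_def w_def[symmetric] power2_eq_square algebra_simps)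
        also have "\<dots> \<le> s * t\<^sup>2 * (- (w \<bullet> w))"
        proof -
          have "t * (w \<bullet> (B *v w)) \<le> T * b"
          proof -
            have "t * (w \<bullet> (B *v w)) \<le> t * b"
              using t by (intro mult_left_mono) (auto simp: b_def)
            also have "\<dots> \<le> T * b"
              using t by (intro mult_right_mono) (auto simp: b_def)
            finally show ?thesis .
          qed
          then have "s * (a + t * (w \<bullet> (B *v w))) \<le> s * (a + T * b)"
            using s by (intro mult_left_mono) auto
          then have "s * (a + t * (w \<bullet> (B *v w))) - 2 * (w \<bullet> w) \<le> - (w \<bullet> w)"
            using sab by linarith
          then show ?thesis
            using s by (intro mult_left_mono) auto
        qed
        finally show ?thesis by (simp add: mult_ac)
      qed
      ultimately show "\<exists>x. norm x \<le> norm z + s * T * norm w + 1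
          \<and> x \<bullet> ((A + t *\<^sub>R B) *v x) \<le> - (s * (w \<bullet> w)) * t\<^sup>2"
        by blast
    qed (use s w T in \<open>auto intro!: add_nonneg_pos\<close>)
  qed
qed

text \<open>
  Evaluating at a fixed vector \<open>x\<close> is Lipschitz in the matrix with constant \<open>\<parallel>x\<parallel>\<^sup>2\<close>, so a value
  \<open>- c t\<^sup>2\<close> at a vector of norm at most \<open>R\<close> keeps every positive semidefinite matrix at distance
  \<open>c t\<^sup>2 / R\<^sup>2\<close>.
\<close>

lemma psd_cone_error_bound_ray:
  fixes A B :: "real ^ 'n ^ 'n"
  assumes A: "A \<in> psd_cone" and B: "B \<in> sym_matrices" and T: "T > 0"
    and leaves: "\<And>t. t > 0 \<Longrightarrow> A + t *\<^sub>R B \<notin> psd_cone"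
  obtains c where "c > 0"
    "\<And>t V. 0 \<le> t \<Longrightarrow> t \<le> T \<Longrightarrow> V \<in> psd_cone \<Longrightarrow> c * t\<^sup>2 \<le> norm (V - (A + t *\<^sub>R B))"
proof -
  obtain c R where c: "c > 0" and R: "R > 0" and neg:
    "\<And>t. 0 \<le> t \<Longrightarrow> t \<le> T \<Longrightarrow> \<exists>x. norm x \<le> R \<and> x \<bullet> ((A + t *\<^sub>R B) *v x) \<le> - c * t\<^sup>2"
    using negative_vectors_along_ray[OF A B T leaves] by blast
  show ?thesis
  proof (rule that[of "c / R\<^sup>2"])
    fix t V assume t: "0 \<le> t" "t \<le> T" and V: "V \<in> (psd_cone :: (real ^ 'n ^ 'n) set)"
    obtain x where x: "norm x \<le> R" and q: "x \<bullet> ((A + t *\<^sub>R B) *v x) \<le> - c * t\<^sup>2"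
      using neg[OF t] by blast
    have "c * t\<^sup>2 \<le> x \<bullet> (V *v x) - x \<bullet> ((A + t *\<^sub>R B) *v x)"
    proof -
      have "0 \<le> x \<bullet> (V *v x)"
        using V by (simp add: psd_cone_def)
      then show ?thesis
        using q by linarith
    qed
    also have "\<dots> = x \<bullet> ((V - (A + t *\<^sub>R B)) *v x)"
      by (simp only: matrix_vector_mult_diff_rdistrib inner_diff_right)
    also have "\<dots> \<le> norm (V - (A + t *\<^sub>R B)) * (norm x)\<^sup>2"
      using quadratic_form_abs_le[of x "V - (A + t *\<^sub>R B)"] by linarith
    also have "\<dots> \<le> norm (V - (A + t *\<^sub>R B)) * R\<^sup>2"
      using x by (intro mult_left_mono power_mono) auto
    finally show "c / R\<^sup>2 * t\<^sup>2 \<le> norm (V - (A + t *\<^sub>R B))"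
      using R by (simp add: field_simps)
  qed (use c R in auto)
qed

lemma psd_cone_quadratic_error_bound:
  fixes A B :: "real ^ 'n ^ 'n"
  assumes A: "A \<in> psd_cone" and B: "B \<in> sym_matrices" "B \<noteq> 0" and T: "T > 0"
    and single: "psd_cone \<inter> matrix_line A B = {A}"
  obtains c where "c > 0"
    "\<And>t V. \<bar>t\<bar> \<le> T \<Longrightarrow> V \<in> psd_cone \<Longrightarrow> c * t\<^sup>2 \<le> norm (V - (A + t *\<^sub>R B))"
proof -
  have leaves: "A + t *\<^sub>R B \<notin> psd_cone" if "t \<noteq> 0" for t
  proof
    assume "A + t *\<^sub>R B \<in> psd_cone"
    then have "A + t *\<^sub>R B \<in> psd_cone \<inter> matrix_line A B"
      by (auto simp: matrix_line_def)
    then have "A + t *\<^sub>R B = A"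
      unfolding single by simp
    then show False
      using that B by simp
  qed
  have B': "- B \<in> sym_matrices"
    using subspace_neg[OF subspace_sym_matrices B(1)] .
  obtain c where c: "c > 0" and c_le:
    "\<And>t V. 0 \<le> t \<Longrightarrow> t \<le> T \<Longrightarrow> V \<in> psd_cone \<Longrightarrow> c * t\<^sup>2 \<le> norm (V - (A + t *\<^sub>R B))"
    using psd_cone_error_bound_ray[OF A B(1) T] leaves by (metis less_irrefl)
  have "\<And>t. t > 0 \<Longrightarrow> A + t *\<^sub>R (- B) \<notin> psd_cone"
    using leaves[of "- t" for t] by simp
  then obtain d where d: "d > 0" and d_le:
    "\<And>t V. 0 \<le> t \<Longrightarrow> t \<le> T \<Longrightarrow> V \<in> psd_cone \<Longrightarrow> d * t\<^sup>2 \<le> norm (V - (A + t *\<^sub>R (- B)))"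
    using psd_cone_error_bound_ray[OF A B' T] by blast
  show ?thesis
  proof (rule that[of "min c d"])
    fix t V assume t: "\<bar>t\<bar> \<le> T" and V: "V \<in> (psd_cone :: (real ^ 'n ^ 'n) set)"
    show "min c d * t\<^sup>2 \<le> norm (V - (A + t *\<^sub>R B))"
    proof (cases "0 \<le> t")
      case True
      have "min c d * t\<^sup>2 \<le> c * t\<^sup>2"
        by (intro mult_right_mono) auto
      also have "\<dots> \<le> norm (V - (A + t *\<^sub>R B))"
        using c_le[of t V] t V True by simp
      finally show ?thesis .
    next
      case False
      have "min c d * t\<^sup>2 \<le> d * t\<^sup>2"
        by (intro mult_right_mono) auto
      also have "\<dots> \<le> norm (V - (A + t *\<^sub>R B))"
        using d_le[of "- t" V] t V False by simp
      finally show ?thesis .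
    qed
  qed (use c d in simp)
qed

section \<open>The rate of convergence\<close>

text \<open>
  The projection onto \<open>K\<close> sees \<open>u\<close> and \<open>a\<close> under an obtuse angle, which yields the decrease; the
  projection onto \<open>E\<close> does not increase the distance to its fixed point \<open>a\<close>.
\<close>

lemma alternating_projection_decrease:
  fixes K E :: "'a::euclidean_space set"
  assumes K: "closed K" "convex K" and E: "closed E" "convex E" and a: "a \<in> K" "a \<in> E"
  shows "(norm (closest_point E (closest_point K u) - a))\<^sup>2
    \<le> (norm (u - a))\<^sup>2 - (norm (closest_point K u - u))\<^sup>2"
proof -
  let ?v = "closest_point K u"
  have "dist (closest_point E ?v) (closest_point E a) \<le> dist ?v a"
    using E a by (intro closest_point_lipschitz) auto
  then have "(norm (closest_point E ?v - a))\<^sup>2 \<le> (norm (?v - a))\<^sup>2"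
    using a by (simp add: closest_point_self dist_norm)
  also have "\<dots> = (norm (u - a))\<^sup>2 - (norm (?v - u))\<^sup>2 + 2 * ((u - ?v) \<bullet> (a - ?v))"
    by (simp add: power2_norm_eq_inner inner_diff_left inner_diff_right inner_commute)
  finally show ?thesis
    using closest_point_dot[OF K(2,1) a(1), of u] by linarith
qed

text \<open>
  The discrete analogue of \<open>s' = - d s\<^sup>2\<close>, whose solutions are \<open>1 / (d k + const)\<close>. With
  \<open>y = d s k\<close>, the induction step is the identity
  \<open>1 - (k + 1) y (1 - y) = (1 - k y) (1 - y) + y\<^sup>2\<close>.
\<close>

lemma quadratic_decrease_rate:
  fixes s :: "nat \<Rightarrow> real"
  assumes d: "d > 0" and s: "\<And>k. s k \<ge> 0" and step: "\<And>k. s (Suc k) \<le> s k - d * (s k)\<^sup>2"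
  shows "d * real k * s k \<le> 1"
proof (induction k)
  case (Suc k)
  define y where "y = d * s k"
  have "y \<le> 1"
  proof (rule ccontr)
    assume "\<not> y \<le> 1"
    then have "s k * (1 - y) < 0"
      using s[of k] d by (intro mult_pos_neg) (auto simp: y_def less_le)
    then show False
      using step[of k] s[of "Suc k"] by (simp add: y_def power2_eq_square algebra_simps)
  qed
  moreover have "real k * y \<le> 1"
    using Suc by (simp add: y_def mult_ac)
  ultimately have "0 \<le> (1 - real k * y) * (1 - y) + y\<^sup>2"
    by simp
  then have "real (Suc k) * (y * (1 - y)) \<le> 1"
    by (simp add: algebra_simps power2_eq_square)
  moreover have "d * real (Suc k) * s (Suc k) \<le> d * real (Suc k) * (s k - d * (s k)\<^sup>2)"
    using step d by (intro mult_left_mono) auto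
  ultimately show ?case
    by (simp add: y_def power2_eq_square algebra_simps)
qed simp

theorem theorem1p1:
  fixes A B :: "real ^ 'n ^ 'n" and U :: "nat \<Rightarrow> real ^ 'n ^ 'n"
  assumes "A \<in> psd_cone"
    and "B \<in> sym_matrices"
    and "B \<noteq> 0"
    and "alternating_projections psd_cone (matrix_line A B) U"
    and "psd_cone \<inter> matrix_line A B = {A}"
  shows "(\<lambda>k. norm (U k - A)) \<in> O(\<lambda>k. real k powr (-1/2))"
proof -
  let ?K = "psd_cone :: (real ^ 'n ^ 'n) set" and ?E = "matrix_line A B"
  have E: "closed ?E" "convex ?E" "A \<in> ?E"
    using matrix_line_affine[of A B]
    by (simp_all add: affine_closed affine_imp_convex matrix_line_nonempty)
  have U0: "U 0 \<in> ?E"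
    and US: "U (Suc k) = closest_point ?E (closest_point ?K (U k))" for k
    using assms(4) by (auto simp: alternating_projections_def)
  have UE: "U k \<in> ?E" for k
  proof (cases k)
    case (Suc j)
    then show ?thesis
      using E US closest_point_in_set[of ?E] by auto
  qed (use U0 in simp)
  define s where "s k = (norm (U k - A))\<^sup>2" for k
  have decrease: "s (Suc k) \<le> s k - (norm (closest_point ?K (U k) - U k))\<^sup>2" for k
    unfolding s_def US
    using psd_cone_closed psd_cone_convex E assms(1)
    by (intro alternating_projection_decrease)
  have "s (Suc k) \<le> s k" for k
    using decrease[of k] by (smt (verit) zero_le_power2)
  then have "s k \<le> s 0" for k
    by (induction k) (auto intro: order_trans)
  then have bounded: "norm (U k - A) \<le> norm (U 0 - A)" for k
    using power2_le_imp_le[of "norm (U k - A)" "norm (U 0 - A)"] by (simp add: s_def)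
  define b where "b = norm B"
  have b: "b > 0"
    using assms(3) by (simp add: b_def)
  \<comment> \<open>The summand 1 only keeps the length of the interval positive when \<open>U 0 = A\<close>.\<close>
  define T where "T = norm (U 0 - A) / b + 1"
  have "T > 0"
    using b by (auto simp: T_def intro!: add_nonneg_pos)
  then obtain c where c: "c > 0" and c_le:
    "\<And>t V. \<bar>t\<bar> \<le> T \<Longrightarrow> V \<in> psd_cone \<Longrightarrow> c * t\<^sup>2 \<le> norm (V - (A + t *\<^sub>R B))"
    using psd_cone_quadratic_error_bound[OF assms(1-3) _ assms(5)] by blast
  define d where "d = (c / b\<^sup>2)\<^sup>2"
  have d: "d > 0"
    using b c by (simp add: d_def)
  have "s (Suc k) \<le> s k - d * (s k)\<^sup>2" for k
  proof -
    obtain t where t: "U k = A + t *\<^sub>R B"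
      using UE[of k] by (auto simp: matrix_line_def)
    then have norm_t: "norm (U k - A) = \<bar>t\<bar> * b"
      by (simp add: b_def)
    then have "\<bar>t\<bar> \<le> T"
      using bounded[of k] b by (simp add: T_def field_simps)
    then have "c * t\<^sup>2 \<le> norm (closest_point ?K (U k) - U k)"
      unfolding t using psd_cone_closed psd_cone_nonempty
      by (intro c_le closest_point_in_set)
    moreover have "c * t\<^sup>2 = c / b\<^sup>2 * s k"
      using b by (simp add: s_def norm_t power_mult_distrib)
    ultimately have "(c / b\<^sup>2 * s k)\<^sup>2 \<le> (norm (closest_point ?K (U k) - U k))\<^sup>2"
      using c by (intro power_mono) (auto simp: s_def)
    then show ?thesis
      using decrease[of k] by (simp add: d_def power_mult_distrib power_divide)
  qed
  then have rate: "d * real k * s k \<le> 1" for k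
    using d by (intro quadratic_decrease_rate) (auto simp: s_def)
  have "norm (U k - A) \<le> sqrt (1 / d) * (real k powr (-1/2))" if "k \<ge> 1" for k
  proof -
    have "s k \<le> 1 / d * (1 / real k)"
      using rate[of k] d that by (simp add: field_simps)
    then have "norm (U k - A) \<le> sqrt (1 / d * (1 / real k))"
      by (intro real_le_rsqrt) (simp add: s_def)
    also have "\<dots> = sqrt (1 / d) * (1 / sqrt (real k))"
      by (simp only: real_sqrt_mult real_sqrt_divide real_sqrt_one)
    also have "1 / sqrt (real k) = real k powr (-1/2)"
      using powr_minus_divide[of "real k" "1/2"] by (simp add: powr_half_sqrt)
    finally show ?thesis .
  qed
  then show ?thesis
    by (intro landau_o.bigI[of "sqrt (1 / d)"] eventually_sequentiallyI[of 1]) (use d in auto)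
qed

end
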